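(* Let $\mathcal{T}$ be an RGBK-tournament. If $\mathcal{T}$ is canonically-almost morally $K$-free, canonically-almost directed-Gallai, canonically-almost undirected-Gallai, or canonically-almost morally rainbow-triangle free, then $$\ell(RGK)\cdot\ell(RBK)\cdot\ell(GBK)\ge |V(\mathcal{T})|^2 .$$
   Context: An *RGBK-tournament* is a transitive tournament on ordered vertices $v_1,\dots,v_N$ with each edge $v_i\to v_j$ ($i<j$) colored one of four colors $R,G,B,K$; $R,G,B$ are the primary colors. A *color class* is a set of colors, written as a string (e.g. $RGK=\{R,G,K\}$). $\ell(C)=\ell_{\mathcal{T}}(C)$ is the maximum number of vertices of a directed path in $\mathcal{T}$ all of whose edges have colors in $C$ (length always counts vertices; a single vertex is a path). A finite set $S\subseteq\mathbb{R}^3$ is *ordered* if it can be listed as $L_1,\dots,L_{|S|}$ such that for all $i<j$ the difference $L_j-L_i$ has at least two strictly positive coordinates. $\operatorname{Record}(\mathcal{T})\subseteq\mathbb{Z}_{>0}^3$ is the ordered set whose triples, listed in the order of the vertices, are $(x_v,y_v,z_v)$, where $x_v,y_v,z_v$ are the lengths of the longest $RGK$-, $RBK$-, $GBK$-colored directed paths ending at $v$. For an ordered set $S$ with listing $L_1,\dots,L_{|S|}$, $\operatorname{Color}(S)$ is the RGBK-tournament on $v_1,\dots,v_{|S|}$ in which, for $i<j$, $v_i\to v_j$ is colored according to $L_j-L_i$: $R$ if $(+,+,\le 0)$, $G$ if $(+,\le 0,+)$, $B$ if $(\le 0,+,+)$, $K$ if $(+,+,+)$, where $+$ means strictly positive.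 $\operatorname{Dual}(\mathcal{T})$ is obtained by reversing all edge directions (hence the vertex order) and keeping edge colors. $\mathcal{T}$ *canonically-almost has* property $\mathcal{P}$ if one can apply some finite composition of the maps $\operatorname{Color}\circ\operatorname{Record}$ and $\operatorname{Dual}$ to $\mathcal{T}$ to obtain a tournament with property $\mathcal{P}$. An RGBK-tournament is *geometric* if it equals $\operatorname{Color}(S)$ for some ordered set $S\subseteq\mathbb{R}^3$. It is *morally $K$-free* if one can recolor each $K$-edge with a primary color (one of $R,G,B$) so as to get a geometric tournament with no $K$-edges. It is *morally rainbow-triangle free* if one can recolor each $K$-edge with a primary color so as to get a tournament with no rainbow triangle (no triangle whose three edges have colors $R,G,B$ in some order). *Undirected-Gallai* is defined recursively: the single-vertex tournament is undirected-Gallai; and a tournament is undirected-Gallai if its vertex set can be partitioned into $m\ge 2$ nonempty blocks $H_1,\dots,H_m$, each inducing an undirected-Gallai tournament, such that the edges between any two distinct blocks use at most one of the colors $R,G,B$, and the edges between distinct blocks in total use at most two of the colors $R,G,B$ (no condition is imposed on $K$-edges). *Directed-Gallai* is defined by the same recursion (with "directed-Gallai" blocks) with the extra requirement at each step that the blocks be directed: for $i<j$, every edge between $H_i$ and $H_j$ is directed from $H_i$ to $H_j$. *)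

theory Defs
  imports "HOL-Analysis.Analysis" "HOL-Library.Disjoint_Sets"
begin

section \<open>RGBK-tournaments\<close>

datatype color = R | G | B | K

abbreviation primary :: "color set" where
  "primary \<equiv> {R, G, B}"

text \<open>
  The vertices \<open>v\<^sub>1, \<dots>, v\<^sub>N\<close> are represented by the indices \<open>0, \<dots>, N - 1\<close>. For \<open>i < j < N\<close>,
  \<open>col T i j\<close> is the color of the edge from \<open>i\<close> to \<open>j\<close>; all other values of \<open>col T\<close> are
  meaningless, so equality of tournaments is \<open>same_tournament\<close> rather than \<open>=\<close>.
\<close>

datatype tournament = Tournament (order: nat) (col: "nat \<Rightarrow> nat \<Rightarrow> color")

definition verts :: "tournament \<Rightarrow> nat set" where
  "verts T = {..<order T}"

definition arc :: "tournament \<Rightarrow> nat \<Rightarrow> nat \<Rightarrow> bool" where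
  "arc T u v \<longleftrightarrow> u \<in> verts T \<and> v \<in> verts T \<and> u < v"

definition same_tournament :: "tournament \<Rightarrow> tournament \<Rightarrow> bool" where
  "same_tournament T T' \<longleftrightarrow>
     order T = order T' \<and> (\<forall>u v. arc T u v \<longrightarrow> col T u v = col T' u v)"

text \<open>Color of the edge joining two distinct vertices, irrespective of its direction.\<close>

definition edge_color :: "tournament \<Rightarrow> nat \<Rightarrow> nat \<Rightarrow> color" where
  "edge_color T u v = (if u < v then col T u v else col T v u)"

definition dpath :: "tournament \<Rightarrow> color set \<Rightarrow> nat list \<Rightarrow> bool" where
  "dpath T C p \<longleftrightarrow>
     p \<noteq> [] \<and> set p \<subseteq> verts T \<and> successively (\<lambda>u v. arc T u v \<and> col T u v \<in> C) p"

definition ell :: "tournament \<Rightarrow> color set \<Rightarrow> nat" where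
  "ell T C = Max {length p | p. dpath T C p}"

definition ell_at :: "tournament \<Rightarrow> color set \<Rightarrow> nat \<Rightarrow> nat" where
  "ell_at T C v = Max {length p | p. dpath T C p \<and> last p = v}"

section \<open>Ordered sets, and the maps Record, Color and Dual\<close>

definition before :: "real^3 \<Rightarrow> real^3 \<Rightarrow> bool" where
  "before a b \<longleftrightarrow> card {k. (b - a) $ k > 0} \<ge> 2"

definition is_listing :: "(real^3) list \<Rightarrow> (real^3) set \<Rightarrow> bool" where
  "is_listing L S \<longleftrightarrow> set L = S \<and> distinct L \<and> sorted_wrt before L"

definition ordered_set :: "(real^3) set \<Rightarrow> bool" where
  "ordered_set S \<longleftrightarrow> (\<exists>L. is_listing L S)"

text \<open>An ordered set has exactly one listing; see \<open>is_listing_unique\<close> below.\<close>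

definition listing :: "(real^3) set \<Rightarrow> (real^3) list" where
  "listing S = (THE L. is_listing L S)"

definition diff_color :: "real^3 \<Rightarrow> color" where
  "diff_color d =
     (if d$1 > 0 \<and> d$2 > 0 \<and> d$3 \<le> 0 then R
      else if d$1 > 0 \<and> d$2 \<le> 0 \<and> d$3 > 0 then G
      else if d$1 \<le> 0 \<and> d$2 > 0 \<and> d$3 > 0 then B
      else K)"

definition Color :: "(real^3) set \<Rightarrow> tournament" where
  "Color S = Tournament (card S) (\<lambda>i j. diff_color (listing S ! j - listing S ! i))"

definition record_point :: "tournament \<Rightarrow> nat \<Rightarrow> real^3" where
  "record_point T v =
     vector [real (ell_at T {R,G,K} v), real (ell_at T {R,B,K} v), real (ell_at T {G,B,K} v)]"

definition Record :: "tournament \<Rightarrow> (real^3) set" where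
  "Record T = record_point T ` verts T"

definition Dual :: "tournament \<Rightarrow> tournament" where
  "Dual T = Tournament (order T) (\<lambda>i j. col T (order T - 1 - j) (order T - 1 - i))"

definition canonically_almost :: "(tournament \<Rightarrow> bool) \<Rightarrow> tournament \<Rightarrow> bool" where
  "canonically_almost P T \<longleftrightarrow>
     (\<exists>fs. set fs \<subseteq> {Color \<circ> Record, Dual} \<and> P (foldr (\<circ>) fs id T))"

section \<open>The properties of tournaments\<close>

definition geometric :: "tournament \<Rightarrow> bool" where
  "geometric T \<longleftrightarrow> (\<exists>S. ordered_set S \<and> same_tournament T (Color S))"

definition K_free :: "tournament \<Rightarrow> bool" where
  "K_free T \<longleftrightarrow> (\<forall>u v. arc T u v \<longrightarrow> col T u v \<noteq> K)"

definition rainbow_triangle_free :: "tournament \<Rightarrow> bool" where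
  "rainbow_triangle_free T \<longleftrightarrow>
     \<not> (\<exists>u v w. arc T u v \<and> arc T v w \<and> {col T u v, col T v w, col T u w} = {R, G, B})"

definition recolors_K :: "tournament \<Rightarrow> tournament \<Rightarrow> bool" where
  "recolors_K T T' \<longleftrightarrow> order T' = order T \<and>
     (\<forall>u v. arc T u v \<longrightarrow>
        (if col T u v = K then col T' u v \<in> primary else col T' u v = col T u v))"

definition morally_K_free :: "tournament \<Rightarrow> bool" where
  "morally_K_free T \<longleftrightarrow> (\<exists>T'. recolors_K T T' \<and> geometric T' \<and> K_free T')"

definition morally_rainbow_triangle_free :: "tournament \<Rightarrow> bool" where
  "morally_rainbow_triangle_free T \<longleftrightarrow> (\<exists>T'. recolors_K T T' \<and> rainbow_triangle_free T')"

definition primary_between :: "tournament \<Rightarrow> nat set \<Rightarrow> nat set \<Rightarrow> color set" where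
  "primary_between T X Y = {edge_color T u v | u v. u \<in> X \<and> v \<in> Y} \<inter> primary"

text \<open>\<open>Hs\<close> lists the blocks \<open>H\<^sub>1, \<dots>, H\<^sub>m\<close> of one step of the recursion on the vertex set \<open>W\<close>.\<close>

definition gallai_partition :: "tournament \<Rightarrow> nat set \<Rightarrow> nat set list \<Rightarrow> bool" where
  "gallai_partition T W Hs \<longleftrightarrow>
     length Hs \<ge> 2 \<and> distinct Hs \<and> partition_on W (set Hs) \<and>
     (\<forall>X\<in>set Hs. \<forall>Y\<in>set Hs. X \<noteq> Y \<longrightarrow> card (primary_between T X Y) \<le> 1) \<and>
     card (\<Union>X\<in>set Hs. \<Union>Y\<in>set Hs - {X}. primary_between T X Y) \<le> 2"

definition directed_blocks :: "tournament \<Rightarrow> nat set list \<Rightarrow> bool" where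
  "directed_blocks T Hs \<longleftrightarrow>
     (\<forall>j<length Hs. \<forall>i<j. \<forall>u\<in>Hs ! i. \<forall>v\<in>Hs ! j. arc T u v)"

text \<open>\<open>undirected_gallai_on T W\<close>: the subtournament of \<open>T\<close> induced by \<open>W\<close> is undirected-Gallai.\<close>

inductive undirected_gallai_on :: "tournament \<Rightarrow> nat set \<Rightarrow> bool" for T where
  single: "v \<in> verts T \<Longrightarrow> undirected_gallai_on T {v}"
| step: "gallai_partition T W Hs \<Longrightarrow> (\<forall>H\<in>set Hs. undirected_gallai_on T H) \<Longrightarrow>
           undirected_gallai_on T W"

inductive directed_gallai_on :: "tournament \<Rightarrow> nat set \<Rightarrow> bool" for T where
  single: "v \<in> verts T \<Longrightarrow> directed_gallai_on T {v}"
| step: "gallai_partition T W Hs \<Longrightarrow> directed_blocks T Hs \<Longrightarrow>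
           (\<forall>H\<in>set Hs. directed_gallai_on T H) \<Longrightarrow> directed_gallai_on T W"

definition undirected_gallai :: "tournament \<Rightarrow> bool" where
  "undirected_gallai T \<longleftrightarrow> undirected_gallai_on T (verts T)"

definition directed_gallai :: "tournament \<Rightarrow> bool" where
  "directed_gallai T \<longleftrightarrow> directed_gallai_on T (verts T)"

section \<open>Well-definedness of Color and Record\<close>

lemma before_iff:
  "before a b \<longleftrightarrow> a$1 < b$1 \<and> a$2 < b$2 \<or> a$1 < b$1 \<and> a$3 < b$3 \<or> a$2 < b$2 \<and> a$3 < b$3"
proof -
  have "{k::3. (b - a) $ k > 0} =
      (if a$1 < b$1 then {1} else {}) \<union> (if a$2 < b$2 then {2} else {}) \<union>
      (if a$3 < b$3 then {3} else {})"
    using exhaust_3 by (auto split: if_splits) (metis exhaust_3)+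
  then show ?thesis
    unfolding before_def by (auto simp: card_insert_if)
qed

lemma is_listing_iff:
  "is_listing L S \<longleftrightarrow> set L = S \<and> sorted_wrt before L"
proof -
  have "distinct L" if "sorted_wrt before L"
  proof -
    have "L ! i \<noteq> L ! j" if "i < j" "j < length L" for i j
      using sorted_wrt_nth_less[OF \<open>sorted_wrt before L\<close> that] by (auto simp: before_iff)
    then show ?thesis
      unfolding distinct_conv_nth by (metis linorder_neqE_nat)
  qed
  then show ?thesis
    unfolding is_listing_def by blast
qed

lemma is_listing_unique:
  assumes "is_listing L S" "is_listing L' S"
  shows "L = L'"
proof -
  have anti: "before a b \<Longrightarrow> before b a \<Longrightarrow> False" for a b
    by (auto simp: before_iff)
  have "sorted_wrt before L \<Longrightarrow> sorted_wrt before L' \<Longrightarrow> set L = set L' \<Longrightarrow> L = L'" for L L'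
  proof (induction L arbitrary: L')
    case (Cons a L)
    then obtain b M where L': "L' = b # M"
      by (cases L') auto
    have irr: "\<not> before c c" for c
      using anti by blast
    have "a = b"
      using Cons.prems anti unfolding L' by (metis list.set_intros(1) set_ConsD sorted_wrt.simps(2))
    moreover have "a \<notin> set L" "b \<notin> set M"
      using Cons.prems irr unfolding L' by auto
    ultimately have "set L = set M"
      using Cons.prems(3) unfolding L' by auto
    then show ?case
      using Cons \<open>a = b\<close> unfolding L' by auto
  qed auto
  then show ?thesis
    using assms unfolding is_listing_iff by auto
qed

lemma listing_eq: "is_listing L S \<Longrightarrow> listing S = L"
  unfolding listing_def using is_listing_unique by blast

lemma dpath_length:
  assumes "dpath T C p"
  shows "length p \<le> order T"
proof -
  have "sorted_wrt (<) p"
    using assms unfolding dpath_def arc_def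
    by (intro successively_conv_sorted_wrt[OF transp_on_less, THEN iffD1]) (auto elim: successively_mono)
  then have "card (set p) = length p"
    by (simp add: strict_sorted_iff distinct_card)
  then show ?thesis
    using assms card_mono[of "verts T" "set p"] unfolding dpath_def verts_def by auto
qed

lemma ell_at_less:
  assumes "arc T u v" "col T u v \<in> C"
  shows "ell_at T C u < ell_at T C v"
proof -
  let ?A = "\<lambda>v. {length p | p. dpath T C p \<and> last p = v}"
  have fin: "finite (?A w)" for w
    by (rule finite_subset[of _ "{..order T}"]) (auto dest: dpath_length)
  have "dpath T C [u]"
    using assms by (auto simp: dpath_def arc_def)
  then have "?A u \<noteq> {}"
    by force
  then have "Max (?A u) \<in> ?A u"
    using fin Max_in by blast
  then obtain p where p: "dpath T C p" "last p = u" "length p = ell_at T C u"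
    unfolding ell_at_def by auto
  have "dpath T C (p @ [v])"
    using p assms by (auto simp: dpath_def successively_append_iff arc_def)
  then have "Suc (length p) \<in> ?A v"
    by force
  then have "Suc (length p) \<le> ell_at T C v"
    unfolding ell_at_def by (rule Max_ge[OF fin])
  then show ?thesis
    using p by simp
qed

lemma Record_listing:
  "is_listing (map (record_point T) [0..<order T]) (Record T)"
proof -
  have "before (record_point T u) (record_point T v)" if "u < v" "v < order T" for u v
  proof -
    have "arc T u v"
      using that by (auto simp: arc_def verts_def)
    from ell_at_less[OF this] show ?thesis
      by (cases "col T u v") (auto simp: before_iff record_point_def vector_3)
  qed
  then show ?thesis
    unfolding is_listing_iff Record_def verts_def
    by (auto simp: sorted_wrt_iff_nth_less atLeast0LessThan)
qed

lemma order_Color_Record: "order (Color (Record T)) = order T"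
proof -
  have "card (Record T) = length (map (record_point T) [0..<order T])"
    using Record_listing[of T] unfolding is_listing_def by (metis distinct_card)
  then show ?thesis
    by (simp add: Color_def)
qed

end

theory Submission
  imports Defs
begin

text \<open>
  The four properties have a common consequence: every \<open>K\<close>-edge can be given a primary color in
  such a way that no rainbow triangle arises. For a geometric tournament this holds because two
  primary colors on consecutive edges share a strictly increasing coordinate, which the third color
  forbids (\<open>geometric_imp_rainbow_triangle_free\<close>). For a Gallai tournament, directed or not, all
  edges between two blocks are given one color
  (\<open>undirected_gallai_on_imp_recoloring\<close>). Moreover, on a nonempty
  tournament, neither \<open>Color \<circ> Record\<close> nor \<open>Dual\<close>
  changes the number of vertices or increases one of the three path lengths
  (\<open>canonical_maps_ell_le\<close>), so it suffices to prove the inequality for a tournament that itself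
  has such a recoloring.

  There the direction of the edges enters only once. For a primary color \<open>d\<close>, the length of the
  longest path that avoids \<open>d\<close> and ends at a vertex takes different values at the two ends of any
  edge whose new color is not \<open>d\<close>. What remains is a statement about an undirected three-coloring
  without rainbow triangles (\<open>square_card_le_prod\<close>): given three labellings such that the one
  belonging to \<open>d\<close> separates the ends of every edge of color other than \<open>d\<close>, the square of the
  number of vertices is at most the product of the numbers of labels. Its proof is an induction
  along Gallai's theorem (\<open>gallai_disconnected\<close>): some color does not connect the vertex set, its
  components are pairwise joined in a single one of the two other colors, and the Cauchy-Schwarz
  inequality adds up the estimates for the components.

  The class of all colors except \<open>d\<close>, such as \<open>RGK\<close> for \<open>d = B\<close>, is written \<open>- {d}\<close>, which
  makes the three color classes symmetric.
\<close>

section \<open>Three-colorings without rainbow triangles\<close>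

definition gallai_coloring :: "('v \<Rightarrow> 'v \<Rightarrow> color) \<Rightarrow> 'v set \<Rightarrow> bool" where
  "gallai_coloring f W \<longleftrightarrow>
     (\<forall>u\<in>W. \<forall>v\<in>W. u \<noteq> v \<longrightarrow> f u v \<in> primary \<and> f u v = f v u) \<and>
     (\<forall>u\<in>W. \<forall>v\<in>W. \<forall>w\<in>W. u \<noteq> v \<longrightarrow> v \<noteq> w \<longrightarrow> u \<noteq> w \<longrightarrow>
        f u v = f v w \<or> f u v = f u w \<or> f v w = f u w)"

lemma gallai_coloring_subset: "gallai_coloring f W \<Longrightarrow> V \<subseteq> W \<Longrightarrow> gallai_coloring f V"
  unfolding gallai_coloring_def by blast

lemma gallai_coloring_primary:
  "gallai_coloring f W \<Longrightarrow> u \<in> W \<Longrightarrow> v \<in> W \<Longrightarrow> u \<noteq> v \<Longrightarrow> f u v \<in> primary"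
  unfolding gallai_coloring_def by blast

lemma gallai_coloring_sym:
  "gallai_coloring f W \<Longrightarrow> u \<in> W \<Longrightarrow> v \<in> W \<Longrightarrow> f u v = f v u"
  unfolding gallai_coloring_def by (cases "u = v") auto

lemma gallai_coloring_triangle:
  assumes "gallai_coloring f W" "u \<in> W" "v \<in> W" "w \<in> W" "u \<noteq> v" "v \<noteq> w" "u \<noteq> w"
  shows "f u v = f v w \<or> f u v = f u w \<or> f v w = f u w"
  using assms unfolding gallai_coloring_def by blast

text \<open>
  On \<open>W\<close> this is the relation of lying in the same connected component of the graph formed by
  the edges of color \<open>c\<close>. The intersection with \<open>W \<times> W\<close> discards the pairs \<open>(x, x)\<close> with
  \<open>x\<close> outside \<open>W\<close>, so that the relation is an equivalence on \<open>W\<close> and \<open>W // linked f W c\<close>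
  is the set of components.
\<close>

definition linked :: "('v \<Rightarrow> 'v \<Rightarrow> color) \<Rightarrow> 'v set \<Rightarrow> color \<Rightarrow> ('v \<times> 'v) set" where
  "linked f W c = {(u, v). u \<in> W \<and> v \<in> W \<and> u \<noteq> v \<and> f u v = c}\<^sup>* \<inter> W \<times> W"

lemma equiv_linked:
  assumes "gallai_coloring f W"
  shows "equiv W (linked f W c)"
proof -
  let ?E = "{(u, v). u \<in> W \<and> v \<in> W \<and> u \<noteq> v \<and> f u v = c}"
  have "sym ?E"
    using gallai_coloring_sym[OF assms] by (auto simp: sym_def)
  then have "sym (?E\<^sup>*)"
    by (rule sym_rtrancl)
  then show ?thesis
    unfolding linked_def
    by (auto intro!: equivI refl_onI symI transI dest: symD rtrancl_trans)
qed

lemma linked_edge: "u \<in> W \<Longrightarrow> v \<in> W \<Longrightarrow> u \<noteq> v \<Longrightarrow> f u v = c \<Longrightarrow> (u, v) \<in> linked f W c"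
  unfolding linked_def by auto

text \<open>
  Walk from \<open>u\<close> to \<open>u'\<close> along edges \<open>a b\<close> of color \<open>c\<close>. The two other sides of the
  triangle \<open>a b w\<close> run to a different component, hence do not have color \<open>c\<close>, so the absence
  of rainbow triangles forces them to agree.
\<close>

lemma unlinked_color_cong:
  assumes g: "gallai_coloring f W" and uu: "(u, u') \<in> linked f W c"
    and w: "w \<in> W" "(u, w) \<notin> linked f W c"
  shows "f u w = f u' w"
proof -
  let ?E = "{(u, v). u \<in> W \<and> v \<in> W \<and> u \<noteq> v \<and> f u v = c}"
  have u: "u \<in> W" and *: "(u, u') \<in> ?E\<^sup>*"
    using uu unfolding linked_def by auto
  from * show ?thesis
  proof (induction rule: rtrancl_induct)
    case (step a b)
    have ab: "a \<in> W" "b \<in> W" "a \<noteq> b" "f a b = c"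
      using step.hyps(2) by auto
    have ua: "(u, a) \<in> linked f W c" "(u, b) \<in> linked f W c"
      using step.hyps(1) rtrancl_into_rtrancl[OF step.hyps] u ab(1,2) unfolding linked_def by blast+
    have far: "t \<noteq> w \<and> f t w \<noteq> c" if "(u, t) \<in> linked f W c" for t
    proof -
      have "t \<in> W" using that unfolding linked_def by auto
      then show ?thesis
        using that w linked_edge[of t W w f c] equiv_linked[OF g, of c]
        unfolding equiv_def trans_def by metis
    qed
    show ?case
      using gallai_coloring_triangle[OF g, of a b w] ab w far[OF ua(1)] far[OF ua(2)] step.IH
      by metis
  qed simp
qed

text \<open>
  Thus a single color, different from \<open>c\<close>, joins two given components of color \<open>c\<close>: the
  components form a Gallai partition.
\<close>

lemma unlinked_color_cong2:
  assumes g: "gallai_coloring f W" and "(u, u') \<in> linked f W c" "(w, w') \<in> linked f W c"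
    and "(u, w) \<notin> linked f W c"
  shows "f u w = f u' w'"
proof -
  have W: "u \<in> W" "u' \<in> W" "w \<in> W" "w' \<in> W"
    using assms unfolding linked_def by auto
  have n: "(w, u') \<notin> linked f W c"
    using assms equiv_linked[OF g, of c] unfolding equiv_def sym_def trans_def by metis
  have "f u w = f u' w"
    using unlinked_color_cong[OF g assms(2) _ assms(4)] W by blast
  also have "\<dots> = f w u'" using gallai_coloring_sym[OF g] W by blast
  also have "\<dots> = f w' u'"
    using unlinked_color_cong[OF g assms(3) _ n] W by blast
  also have "\<dots> = f u' w'" using gallai_coloring_sym[OF g] W by blast
  finally show ?thesis .
qed

lemma unlinked_color_neq:
  "gallai_coloring f W \<Longrightarrow> u \<in> W \<Longrightarrow> w \<in> W \<Longrightarrow> (u, w) \<notin> linked f W c \<Longrightarrow> u \<noteq> w \<and> f u w \<noteq> c"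
  using linked_edge[of u W w f c] equiv_linked[of f W c] unfolding equiv_def refl_on_def by blast

text \<open>
  Gallai's theorem for three colors: some color does not connect \<open>W\<close>. The induction adds a
  vertex \<open>v\<close> to a set \<open>W\<close> that color \<open>c\<close> does not connect. If some \<open>c\<close>-component of \<open>W\<close>
  receives no \<open>c\<close>-edge from \<open>v\<close>, then \<open>c\<close> still disconnects the larger set. Otherwise \<open>v\<close>
  has a \<open>c\<close>-neighbor in every component. An edge from \<open>v\<close> to \<open>w\<close> of color \<open>d \<noteq> c\<close> then
  forces color \<open>d\<close> between the component of \<open>w\<close> and every other component, because of the
  triangles formed with those neighbors. As there are at least two components, only one such \<open>d\<close>
  can occur, and the third color misses \<open>v\<close> entirely, which isolates \<open>v\<close> in that color.
\<close>

lemma gallai_disconnected: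
  assumes "finite W" "card W \<ge> 2" "gallai_coloring f W"
  shows "\<exists>c\<in>primary. \<exists>u\<in>W. \<exists>v\<in>W. (u, v) \<notin> linked f W c"
  using assms
proof (induction W rule: finite_induct)
  case (insert v W)
  have g: "gallai_coloring f W"
    using insert.prems(2) gallai_coloring_subset by blast
  \<comment> \<open>A set \<open>A\<close> that no edge of color \<open>c\<close> leaves contains the component of each of its points.\<close>
  have cut: "\<exists>u\<in>insert v W. \<exists>w\<in>insert v W. (u, w) \<notin> linked f (insert v W) c"
    if A: "A \<noteq> {}" "A \<subseteq> insert v W" "\<not> insert v W \<subseteq> A"
      and c: "\<forall>a\<in>A. \<forall>b\<in>insert v W - A. f a b \<noteq> c" for A c
  proof -
    obtain a b where ab: "a \<in> A" "b \<in> insert v W - A"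
      using A by auto
    have "y \<in> A" if "(a, y) \<in> {(p, q). p \<in> insert v W \<and> q \<in> insert v W \<and> p \<noteq> q \<and> f p q = c}\<^sup>*" for y
      using that by (induction rule: rtrancl_induct) (use ab c in auto)
    then have "(a, b) \<notin> linked f (insert v W) c"
      using ab unfolding linked_def by auto
    then show ?thesis using ab A by blast
  qed
  have isolated: ?case if c: "c \<in> primary" "\<forall>b\<in>W. f v b \<noteq> c" for c
  proof -
    have "W \<noteq> {}" using insert by auto
    then show ?thesis
      using cut[of "{v}" c] c insert.hyps by auto
  qed
  show ?case
  proof (cases "card W \<ge> 2")
    case False
    then have "card W = 1" using insert by simp
    then obtain u where u: "W = {u}" by (auto simp: card_1_singleton_iff)
    obtain c where "c \<in> primary" "c \<noteq> f v u" by (cases "f v u") auto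
    then show ?thesis using isolated[of c] u by auto
  next
    case True
    then obtain c p q where c: "c \<in> primary" and pq: "p \<in> W" "q \<in> W" "(p, q) \<notin> linked f W c"
      using insert.IH g by blast
    let ?r = "linked f W c"
    have eq: "equiv W ?r" using equiv_linked[OF g] .
    have r: "(a, a) \<in> ?r" if "a \<in> W" for a
      using eq that unfolding equiv_def refl_on_def by blast
    have s: "(b, a) \<in> ?r" if "(a, b) \<in> ?r" for a b
      using eq that unfolding equiv_def sym_def by blast
    have t: "(a, d) \<in> ?r" if "(a, b) \<in> ?r" "(b, d) \<in> ?r" for a b d
      using eq that unfolding equiv_def trans_def by blast
    show ?thesis
    proof (cases "\<exists>u\<in>W. \<forall>b. (u, b) \<in> ?r \<longrightarrow> f v b \<noteq> c")
      case True
      then obtain u where u: "u \<in> W" "\<And>b. (u, b) \<in> ?r \<Longrightarrow> f v b \<noteq> c" by blast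
      have sub: "?r `` {u} \<subseteq> W" unfolding linked_def by auto
      have "f a b \<noteq> c" if ab: "a \<in> ?r `` {u}" "b \<in> insert v W - ?r `` {u}" for a b
      proof (cases "b = v")
        case True
        then show ?thesis
          using u(2)[of a] ab sub gallai_coloring_sym[OF insert.prems(2), of a v] by auto
      next
        case False
        then have "b \<in> W" "(a, b) \<notin> ?r" "a \<in> W" using ab sub t by auto
        then show ?thesis using unlinked_color_neq[OF g] by blast
      qed
      then show ?thesis
        using cut[of "?r `` {u}" c] sub r[OF u(1)] c insert.hyps by blast
    next
      case False
      then have reach: "\<exists>b. (u, b) \<in> ?r \<and> f v b = c" if "u \<in> W" for u
        using that by blast
      have outside: "f u w = f v w" if w: "w \<in> W" "f v w \<noteq> c" and u: "u \<in> W" "(u, w) \<notin> ?r" for u w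
      proof -
        obtain b where b: "(u, b) \<in> ?r" "f v b = c" using reach[OF u(1)] by blast
        have bW: "b \<in> W" using b unfolding linked_def by auto
        have "(b, w) \<notin> ?r" using b u t by blast
        then have bw: "b \<noteq> w" "f b w \<noteq> c" using unlinked_color_neq[OF g bW w(1)] by auto
        have "f b w = f v w"
          using gallai_coloring_triangle[OF insert.prems(2), of v b w] b bw bW w insert.hyps
          by auto
        moreover have "f u w = f b w"
          using unlinked_color_cong[OF g b(1) w(1) u(2)] .
        ultimately show ?thesis by simp
      qed
      have same: "f v w = f v w'"
        if w: "w \<in> W" "f v w \<noteq> c" and w': "w' \<in> W" "f v w' \<noteq> c" for w w'
      proof (cases "(w, w') \<in> ?r")
        case True
        obtain u where u: "u \<in> W" "(u, w) \<notin> ?r"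
          using pq s t by blast
        then have "(u, w') \<notin> ?r" using True s t by blast
        then show ?thesis
          using outside[OF w u] outside[OF w' u(1)] unlinked_color_cong2[OF g r[OF u(1)] True u(2)]
          by simp
      next
        case False
        then have "(w', w) \<notin> ?r" using s by blast
        with False show ?thesis
          using outside[OF w w'(1)] outside[OF w' w(1)] gallai_coloring_sym[OF g w(1) w'(1)]
          by auto
      qed
      have "\<exists>e\<in>primary. \<forall>b\<in>W. f v b \<noteq> e"
      proof (cases "\<exists>w\<in>W. f v w \<noteq> c")
        case True
        then obtain w where w: "w \<in> W" "f v w \<noteq> c" by blast
        obtain e where "e \<in> primary" "e \<noteq> c" "e \<noteq> f v w"
          by (cases c; cases "f v w") auto
        then show ?thesis using same w by metis
      next
        case False
        obtain e where "e \<in> primary" "e \<noteq> c" by (cases c) auto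
        then show ?thesis using False by auto
      qed
      then show ?thesis using isolated by blast
    qed
  qed
qed simp

text \<open>
  The combinatorial core. Three labellings of the vertices are given, one for each primary color,
  and an edge may fail to be separated only by the labelling that belongs to its own color. By
  Gallai's theorem some color \<open>c\<close> splits \<open>W\<close> into components \<open>H\<close>. All edges between
  components avoid \<open>c\<close>, so the sets \<open>h c ` H\<close> are disjoint. With \<open>d\<close> and \<open>e\<close> the other
  two colors, the edges between two given components all avoid \<open>d\<close> or all avoid \<open>e\<close>, so the
  rectangles \<open>h d ` H \<times> h e ` H\<close> are disjoint as well. Writing \<open>a H\<close> and \<open>q H\<close> for the
  two cardinalities, induction and the Cauchy-Schwarz inequality give
  \<open>(\<Sum>H. card H)\<^sup>2 \<le> (\<Sum>H. sqrt (a H) * sqrt (q H))\<^sup>2 \<le> (\<Sum>H. a H) * (\<Sum>H. q H) \<le> a W * q W\<close>.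
\<close>

lemma square_card_le_prod:
  fixes h :: "color \<Rightarrow> 'v \<Rightarrow> 'a"
  assumes "finite W" "gallai_coloring f W"
    and "\<And>d u v. d \<in> primary \<Longrightarrow> u \<in> W \<Longrightarrow> v \<in> W \<Longrightarrow> u \<noteq> v \<Longrightarrow> f u v \<noteq> d \<Longrightarrow> h d u \<noteq> h d v"
  shows "(card W)\<^sup>2 \<le> (\<Prod>d\<in>primary. card (h d ` W))"
  using assms
proof (induction W rule: finite_psubset_induct)
  case (psubset W)
  note g = psubset.prems(1) and sep = psubset.prems(2)
  show ?case
  proof (cases "card W \<ge> 2")
    case False
    then consider "card W = 0" | "card W = 1" by linarith
    then show ?thesis
      by cases (auto simp: card_1_singleton_iff)
  next
    case True
    obtain c u0 v0 where c: "c \<in> primary" and uv: "u0 \<in> W" "v0 \<in> W" "(u0, v0) \<notin> linked f W c"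
      using gallai_disconnected[OF psubset.hyps True g] by blast
    obtain d e where de: "primary = {c, d, e}" "c \<noteq> d" "c \<noteq> e" "d \<noteq> e"
    proof -
      from c consider "c = R" | "c = G" | "c = B" by blast
      then show ?thesis
        by cases (use that[of G B] that[of R B] that[of R G] in auto)
    qed
    define r where "r = linked f W c"
    define P where "P = W // r"
    have eq: "equiv W r" unfolding r_def using equiv_linked[OF g] .
    have UP: "\<Union>P = W" unfolding P_def using Union_quotient[OF eq] .
    have finP: "finite P" unfolding P_def
      using finite_quotient[OF psubset.hyps equiv_type[OF eq]] .
    have sub: "H \<subseteq> W" if "H \<in> P" for H using UP that by blast
    have finH: "finite H" if "H \<in> P" for H using sub[OF that] psubset.hyps finite_subset by blast
    have block: "(u, v) \<in> r" if "H \<in> P" "u \<in> H" "v \<in> H" for H u v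
      using quotient_eq_iff[OF eq, of H H u v] that unfolding P_def by blast
    have proper: "H \<subset> W" if "H \<in> P" for H
      using block[OF that] uv sub[OF that] unfolding r_def by blast
    have disj: "X \<inter> Y = {}" if "X \<in> P" "Y \<in> P" "X \<noteq> Y" for X Y
      using quotient_disj[OF eq] that unfolding P_def by blast
    have apart: "(u, v) \<notin> r" if "X \<in> P" "Y \<in> P" "X \<noteq> Y" "u \<in> X" "v \<in> Y" for X Y u v
      using quotient_eq_iff[OF eq, of X Y u v] that unfolding P_def by blast
    have sepc: "h c ` X \<inter> h c ` Y = {}" if XY: "X \<in> P" "Y \<in> P" "X \<noteq> Y" for X Y
    proof -
      have "h c u \<noteq> h c v" if "u \<in> X" "v \<in> Y" for u v
        using apart[OF XY that] unlinked_color_neq[OF g, of u v c] sub XY that sep[OF c, of u v]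
        unfolding r_def by blast
      then show ?thesis by auto
    qed
    have sepde: "(h d ` X \<times> h e ` X) \<inter> (h d ` Y \<times> h e ` Y) = {}"
      if XY: "X \<in> P" "Y \<in> P" "X \<noteq> Y" for X Y
    proof -
      have fXY: "f u v \<noteq> c" "f u v \<in> primary" "u \<noteq> v" if "u \<in> X" "v \<in> Y" for u v
        using apart[OF XY that] unlinked_color_neq[OF g, of u v c] sub XY that
          gallai_coloring_primary[OF g, of u v]
        unfolding r_def by blast+
      have const: "f u v = f u' v'" if "u \<in> X" "v \<in> Y" "u' \<in> X" "v' \<in> Y" for u v u' v'
        using unlinked_color_cong2[OF g, of u u' c v v'] block XY that apart
        unfolding r_def by blast
      consider "\<forall>u\<in>X. \<forall>v\<in>Y. f u v \<noteq> d" | "\<forall>u\<in>X. \<forall>v\<in>Y. f u v \<noteq> e"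
        using const de(4) by metis
      then show ?thesis
      proof cases
        case 1
        then have "h d u \<noteq> h d v" if "u \<in> X" "v \<in> Y" for u v
          using sep[of d u v] de(1) fXY(3) that sub XY by blast
        then show ?thesis by auto
      next
        case 2
        then have "h e u \<noteq> h e v" if "u \<in> X" "v \<in> Y" for u v
          using sep[of e u v] de(1) fXY(3) that sub XY by blast
        then show ?thesis by auto
      qed
    qed
    define a where "a H = card (h c ` H)" for H
    define q where "q H = card (h d ` H \<times> h e ` H)" for H
    have prod: "(\<Prod>d\<in>primary. card (h d ` H)) = a H * q H" for H
      unfolding a_def q_def de(1) using de(2-4) by (simp add: card_cartesian_product)
    have IH: "(card H)\<^sup>2 \<le> a H * q H" if "H \<in> P" for H
      using psubset.IH[OF proper[OF that] gallai_coloring_subset[OF g sub[OF that]]] sep sub[OF that]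
      unfolding prod by blast
    have aW: "(\<Sum>H\<in>P. a H) = a W"
    proof -
      have "(\<Sum>H\<in>P. a H) = card (\<Union>H\<in>P. h c ` H)"
        unfolding a_def using finP finH sepc by (intro card_UN_disjoint[symmetric]) auto
      also have "(\<Union>H\<in>P. h c ` H) = h c ` W" using UP by blast
      finally show ?thesis unfolding a_def .
    qed
    have qW: "(\<Sum>H\<in>P. q H) \<le> q W"
    proof -
      have "(\<Sum>H\<in>P. q H) = card (\<Union>H\<in>P. h d ` H \<times> h e ` H)"
        unfolding q_def using finP finH sepde by (intro card_UN_disjoint[symmetric]) auto
      also have "\<dots> \<le> q W"
        unfolding q_def using psubset.hyps sub by (intro card_mono) auto
      finally show ?thesis .
    qed
    have cW: "card W = (\<Sum>H\<in>P. card H)"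
      using card_Union_disjoint[of P] finH disj UP unfolding pairwise_def disjnt_def by auto
    have "real (card H) \<le> sqrt (a H) * sqrt (q H)" if "H \<in> P" for H
    proof -
      have "(real (card H))\<^sup>2 \<le> real (a H * q H)"
        using IH[OF that] by (metis of_nat_le_iff of_nat_power)
      then show ?thesis
        by (simp add: real_le_rsqrt flip: real_sqrt_mult)
    qed
    then have "real (card W) \<le> (\<Sum>H\<in>P. sqrt (a H) * sqrt (q H))"
      unfolding cW by (simp add: sum_mono)
    then have "(real (card W))\<^sup>2 \<le> (\<Sum>H\<in>P. sqrt (a H) * sqrt (q H))\<^sup>2"
      by (simp add: power_mono)
    also have "\<dots> \<le> (\<Sum>H\<in>P. (sqrt (a H))\<^sup>2) * (\<Sum>H\<in>P. (sqrt (q H))\<^sup>2)"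
      by (rule Cauchy_Schwarz_ineq_sum)
    also have "\<dots> = real ((\<Sum>H\<in>P. a H) * (\<Sum>H\<in>P. q H))"
      by simp
    also have "\<dots> \<le> real (a W * q W)"
      unfolding aW using qW by (simp add: mult_left_mono del: of_nat_mult)
    finally have "(card W)\<^sup>2 \<le> a W * q W"
      by (metis of_nat_le_iff of_nat_power)
    then show ?thesis unfolding prod .
  qed
qed

section \<open>Longest paths and the maps Color, Record and Dual\<close>

lemma finite_dpath_lengths: "finite {length p | p. dpath T C p \<and> Q p}"
  by (rule finite_subset[of _ "{..order T}"]) (auto dest: dpath_length)

lemma ell_at_bounds:
  assumes "v \<in> verts T"
  shows "ell_at T C v \<in> {1..ell T C}"
proof -
  let ?A = "{length p | p. dpath T C p \<and> last p = v}"
  have "dpath T C [v]" using assms by (auto simp: dpath_def)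
  then have one: "1 \<in> ?A" by force
  moreover have fin: "finite ?A" by (rule finite_dpath_lengths)
  ultimately have "1 \<le> Max ?A" by (intro Max_ge)
  moreover have "Max ?A \<le> Max {length p | p. dpath T C p}"
  proof (rule Max_mono)
    show "?A \<subseteq> {length p | p. dpath T C p}" by blast
    show "?A \<noteq> {}" using one by blast
    show "finite {length p | p. dpath T C p}"
      using finite_dpath_lengths[of T C "\<lambda>_. True"] by simp
  qed
  ultimately show ?thesis unfolding ell_at_def ell_def atLeastAtMost_iff by blast
qed

text \<open>
  The values of \<open>g\<close> along a \<open>C\<close>-colored path strictly increase inside \<open>{1..n}\<close>. This bounds
  \<open>ell\<close> of a transformed tournament by \<open>ell\<close> of the original one, using the longest paths of
  the original as a potential.
\<close>

lemma ell_le_potential: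
  assumes "order T > 0" and "\<And>v. v \<in> verts T \<Longrightarrow> g v \<in> {1..n}"
    and "\<And>u v. arc T u v \<Longrightarrow> col T u v \<in> C \<Longrightarrow> g u < g v"
  shows "ell T C \<le> n"
proof -
  let ?A = "{length p | p. dpath T C p}"
  have "dpath T C [0]" using assms(1) by (auto simp: dpath_def verts_def)
  then have "?A \<noteq> {}" by blast
  moreover have "finite ?A" using finite_dpath_lengths[of T C "\<lambda>_. True"] by simp
  moreover have "length p \<le> n" if p: "dpath T C p" for p
  proof -
    have "successively (<) (map g p)"
      using p assms(3) unfolding dpath_def successively_map by (auto elim: successively_mono)
    then have "sorted_wrt (<) (map g p)"
      using successively_conv_sorted_wrt[OF transp_on_less] by blast
    then have "card (set (map g p)) = length p"
      by (metis distinct_card length_map strict_sorted_iff)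
    moreover have "set (map g p) \<subseteq> {1..n}"
      using p assms(2) unfolding dpath_def by auto
    ultimately show ?thesis
      using card_mono[of "{1..n}" "set (map g p)"] by simp
  qed
  ultimately show ?thesis
    unfolding ell_def by (intro Max.boundedI) blast+
qed

text \<open>
  The recorded lengths of the longest paths avoiding \<open>d\<close> serve as the potential: an edge that has
  color \<open>d\<close> in \<open>T\<close> raises the other two coordinates of the record, so its new color can differ
  from \<open>d\<close> only if it is \<open>K\<close>, that is, if the third coordinate rises too.
\<close>

lemma ell_Color_Record_le:
  assumes "order T > 0" "d \<in> primary"
  shows "ell (Color (Record T)) (- {d}) \<le> ell T (- {d})"
proof (rule ell_le_potential[where g = "ell_at T (- {d})"])
  fix u v assume uv: "arc (Color (Record T)) u v" "col (Color (Record T)) u v \<in> - {d}"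
  have a: "arc T u v" and lt: "u < order T" "v < order T"
    using uv(1) order_Color_Record[of T] by (auto simp: arc_def verts_def)
  have c: "diff_color (record_point T v - record_point T u) \<noteq> d"
    using uv(2) lt by (simp add: Color_def listing_eq[OF Record_listing])
  show "ell_at T (- {d}) u < ell_at T (- {d}) v"
  proof (cases "col T u v = d")
    case False
    then show ?thesis using ell_at_less[OF a] by simp
  next
    case True
    have C: "{R,G,K} = - {B}" "{R,B,K} = - {G}" "{G,B,K} = - {R}"
      using color.exhaust by auto
    have up: "ell_at T (- {e}) u < ell_at T (- {e}) v" if "e \<noteq> d" for e
      using ell_at_less[OF a] True that by auto
    show ?thesis
      using c assms(2) up[of R] up[of G] up[of B] unfolding record_point_def C
      by (auto simp: diff_color_def vector_3 split: if_splits)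
  qed
next
  fix v assume "v \<in> verts (Color (Record T))"
  then have "v \<in> verts T" using order_Color_Record[of T] by (simp add: verts_def)
  then show "ell_at T (- {d}) v \<in> {1..ell T (- {d})}" by (rule ell_at_bounds)
next
  show "order (Color (Record T)) > 0" using assms(1) order_Color_Record[of T] by simp
qed

text \<open>
  The potential is the reversed length: a vertex reached by the longest paths in \<open>T\<close> comes early
  in the dual. The successor keeps the values between 1 and \<open>ell T C\<close>.
\<close>

lemma ell_Dual_le:
  assumes "order T > 0"
  shows "ell (Dual T) C \<le> ell T C"
proof (rule ell_le_potential[where g = "\<lambda>v. Suc (ell T C) - ell_at T C (order T - 1 - v)"])
  fix v assume "v \<in> verts (Dual T)"
  then have "order T - 1 - v \<in> verts T" by (simp add: verts_def Dual_def)
  from ell_at_bounds[OF this, of C]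
  show "Suc (ell T C) - ell_at T C (order T - 1 - v) \<in> {1..ell T C}"
    unfolding atLeastAtMost_iff by linarith
next
  fix u v assume uv: "arc (Dual T) u v" "col (Dual T) u v \<in> C"
  then have a: "arc T (order T - 1 - v) (order T - 1 - u)"
    unfolding arc_def verts_def Dual_def tournament.sel lessThan_iff by linarith
  have "col T (order T - 1 - v) (order T - 1 - u) \<in> C"
    using uv(2) by (simp add: Dual_def)
  then have "ell_at T C (order T - 1 - v) < ell_at T C (order T - 1 - u)"
    by (rule ell_at_less[OF a])
  moreover have "ell_at T C (order T - 1 - u) \<in> {1..ell T C}"
    using a by (intro ell_at_bounds) (simp only: arc_def)
  ultimately show "Suc (ell T C) - ell_at T C (order T - 1 - u) <
      Suc (ell T C) - ell_at T C (order T - 1 - v)"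
    unfolding atLeastAtMost_iff by linarith
next
  show "order (Dual T) > 0" using assms by (simp add: Dual_def)
qed

lemma canonical_maps_ell_le:
  assumes "set fs \<subseteq> {Color \<circ> Record, Dual}" "order T > 0"
  shows "order (foldr (\<circ>) fs id T) = order T \<and>
    (\<forall>d\<in>primary. ell (foldr (\<circ>) fs id T) (- {d}) \<le> ell T (- {d}))"
  using assms(1)
proof (induction fs)
  case (Cons f fs)
  define T' where "T' = foldr (\<circ>) fs id T"
  have "set fs \<subseteq> {Color \<circ> Record, Dual}"
    using Cons.prems by (meson list.set_intros(2) subset_iff)
  then have IH: "order T' = order T" "\<And>d. d \<in> primary \<Longrightarrow> ell T' (- {d}) \<le> ell T (- {d})"
    using Cons.IH unfolding T'_def by blast+
  have pos: "order T' > 0" using IH(1) assms(2) by simp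
  have "f = Color \<circ> Record \<or> f = Dual" using Cons.prems by auto
  then have step: "order (f T') = order T' \<and> (\<forall>d\<in>primary. ell (f T') (- {d}) \<le> ell T' (- {d}))"
  proof
    assume "f = Color \<circ> Record"
    then have "f T' = Color (Record T')" by simp
    then show ?thesis
      using ell_Color_Record_le[OF pos] order_Color_Record[of T'] by simp
  next
    assume f: "f = Dual"
    have "order (Dual T') = order T'" by (simp add: Dual_def)
    then show ?thesis
      unfolding f using ell_Dual_le[OF pos] by simp
  qed
  have fold: "foldr (\<circ>) (f # fs) id T = f T'" unfolding T'_def by simp
  show ?case
    unfolding fold
  proof (intro conjI ballI)
    show "order (f T') = order T" using step IH(1) by simp
    fix d assume d: "d \<in> primary"
    have "ell (f T') (- {d}) \<le> ell T' (- {d})" using step d by blast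
    also have "\<dots> \<le> ell T (- {d})" using IH(2)[OF d] .
    finally show "ell (f T') (- {d}) \<le> ell T (- {d})" .
  qed
qed simp

section \<open>The inequality for recolorings without rainbow triangles\<close>

definition gallai_recoloring :: "tournament \<Rightarrow> nat set \<Rightarrow> (nat \<Rightarrow> nat \<Rightarrow> color) \<Rightarrow> bool" where
  "gallai_recoloring T W f \<longleftrightarrow> gallai_coloring f W \<and>
     (\<forall>u\<in>W. \<forall>v\<in>W. u \<noteq> v \<longrightarrow> edge_color T u v \<in> {K, f u v})"

lemma gallai_recoloringI:
  assumes "\<And>u v. u \<in> W \<Longrightarrow> v \<in> W \<Longrightarrow> u \<noteq> v \<Longrightarrow>
      f u v \<in> primary \<and> f u v = f v u \<and> edge_color T u v \<in> {K, f u v}"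
    and "\<And>u v w. u \<in> W \<Longrightarrow> v \<in> W \<Longrightarrow> w \<in> W \<Longrightarrow> u \<noteq> v \<Longrightarrow> v \<noteq> w \<Longrightarrow> u \<noteq> w \<Longrightarrow>
      f u v = f v w \<or> f u v = f u w \<or> f v w = f u w"
  shows "gallai_recoloring T W f"
  unfolding gallai_recoloring_def gallai_coloring_def
proof (intro conjI ballI impI)
  fix u v assume uv: "u \<in> W" "v \<in> W" "u \<noteq> v"
  show "f u v \<in> primary" "f u v = f v u" "edge_color T u v \<in> {K, f u v}"
    using assms(1)[OF uv] by blast+
qed (rule assms(2))

lemma edge_color_sym: "edge_color T u v = edge_color T v u"
  unfolding edge_color_def by (cases u v rule: linorder_cases) auto

text \<open>
  Label each vertex, for each primary color \<open>d\<close>, with the length of the longest path ending there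
  that avoids \<open>d\<close>. Along an edge whose new color is not \<open>d\<close> the original color is not \<open>d\<close>
  either, being the same or \<open>K\<close>, so that length strictly increases; and it takes at most
  \<open>ell T (- {d})\<close> values.
\<close>

lemma gallai_recoloring_ell:
  assumes "gallai_recoloring T (verts T) f"
  shows "(card (verts T))\<^sup>2 \<le> (\<Prod>d\<in>primary. ell T (- {d}))"
proof -
  have "(card (verts T))\<^sup>2 \<le> (\<Prod>d\<in>primary. card (ell_at T (- {d}) ` verts T))"
  proof (rule square_card_le_prod)
    show "finite (verts T)" by (simp add: verts_def)
    show "gallai_coloring f (verts T)" using assms by (simp add: gallai_recoloring_def)
    fix d u v
    assume *: "d \<in> primary" "u \<in> verts T" "v \<in> verts T" "u \<noteq> v" "f u v \<noteq> d"
    then have "edge_color T u v \<in> {K, f u v}"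
      using assms unfolding gallai_recoloring_def by blast
    then have e: "edge_color T u v \<noteq> d" "edge_color T v u \<noteq> d"
      using *(1,5) edge_color_sym[of T u v] by auto
    from \<open>u \<noteq> v\<close> show "ell_at T (- {d}) u \<noteq> ell_at T (- {d}) v"
    proof (cases u v rule: linorder_cases)
      case less
      then show ?thesis
        using ell_at_less[of T u v "- {d}"] e(1) * by (simp add: arc_def edge_color_def)
    next
      case greater
      then show ?thesis
        using ell_at_less[of T v u "- {d}"] e(2) * by (simp add: arc_def edge_color_def)
    qed simp
  qed
  also have "\<dots> \<le> (\<Prod>d\<in>primary. ell T (- {d}))"
  proof (rule prod_mono)
    fix d
    have "ell_at T (- {d}) ` verts T \<subseteq> {1..ell T (- {d})}"
      using ell_at_bounds by blast
    then have "card (ell_at T (- {d}) ` verts T) \<le> card {1..ell T (- {d})}"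
      by (rule card_mono[rotated]) simp
    then show "0 \<le> card (ell_at T (- {d}) ` verts T) \<and>
        card (ell_at T (- {d}) ` verts T) \<le> ell T (- {d})"
      by simp
  qed
  finally show ?thesis .
qed

section \<open>Each property yields such a recoloring\<close>

lemma morally_rainbow_triangle_free_imp_recoloring:
  assumes "morally_rainbow_triangle_free T"
  shows "\<exists>f. gallai_recoloring T (verts T) f"
proof -
  obtain T' where T': "recolors_K T T'" "rainbow_triangle_free T'"
    using assms unfolding morally_rainbow_triangle_free_def by blast
  let ?f = "edge_color T'"
  have arcs: "arc T u v \<Longrightarrow> col T' u v \<in> primary \<and> col T u v \<in> {K, col T' u v}" for u v
    using T'(1) color.exhaust[of "col T u v"] unfolding recolors_K_def by (metis insertCI)
  have edges: "?f u v \<in> primary \<and> edge_color T u v \<in> {K, ?f u v}"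
    if "u \<in> verts T" "v \<in> verts T" "u \<noteq> v" for u v
    using arcs[of u v] arcs[of v u] that unfolding edge_color_def arc_def by (auto split: if_splits)
  have tri: "?f u v = ?f v w \<or> ?f u v = ?f u w \<or> ?f v w = ?f u w"
    if "u < v" "v < w" "w \<in> verts T" for u v w
  proof -
    have vs: "u \<in> verts T" "v \<in> verts T" "order T' = order T"
      using that T'(1) by (auto simp: verts_def recolors_K_def)
    then have "{?f u v, ?f v w, ?f u w} \<noteq> {R, G, B}"
      using T'(2) that unfolding rainbow_triangle_free_def arc_def edge_color_def verts_def by auto
    moreover have "{p, q, r} = {R, G, B}"
      if "p \<in> primary" "q \<in> primary" "r \<in> primary" "p \<noteq> q" "q \<noteq> r" "p \<noteq> r" for p q r
    proof (rule card_subset_eq)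
      show "card {p, q, r} = card {R, G, B}" using that(4-6) by simp
      show "{p, q, r} \<subseteq> {R, G, B}" using that(1-3) by blast
    qed simp
    moreover have "?f u v \<in> primary" "?f v w \<in> primary" "?f u w \<in> primary"
      using edges[of u v] edges[of v w] edges[of u w] vs(1,2) that by simp_all
    ultimately show ?thesis by metis
  qed
  have "?f u v = ?f v w \<or> ?f u v = ?f u w \<or> ?f v w = ?f u w"
    if "u \<in> verts T" "v \<in> verts T" "w \<in> verts T" "u \<noteq> v" "v \<noteq> w" "u \<noteq> w" for u v w
  proof -
    have "u < v \<and> v < w \<or> u < w \<and> w < v \<or> v < u \<and> u < w \<or>
        v < w \<and> w < u \<or> w < u \<and> u < v \<or> w < v \<and> v < u"
      using that(4-6) by linarith
    then consider "u < v" "v < w" | "u < w" "w < v" | "v < u" "u < w"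
      | "v < w" "w < u" | "w < u" "u < v" | "w < v" "v < u"
      by blast
    then show ?thesis
    proof cases
      case 1
      show ?thesis using tri[OF 1 that(3)] by argo
    next
      case 2
      show ?thesis using tri[OF 2 that(2)] edge_color_sym[of T' w v] by argo
    next
      case 3
      show ?thesis using tri[OF 3 that(3)] edge_color_sym[of T' v u] by argo
    next
      case 4
      show ?thesis using tri[OF 4 that(1)] edge_color_sym[of T' w u] edge_color_sym[of T' v u]
        by argo
    next
      case 5
      show ?thesis using tri[OF 5 that(2)] edge_color_sym[of T' w u] edge_color_sym[of T' w v]
        by argo
    next
      case 6
      show ?thesis using tri[OF 6 that(1)] edge_color_sym[of T' w v] edge_color_sym[of T' v u]
          edge_color_sym[of T' w u]
        by argo
    qed
  qed
  moreover have "?f u v \<in> primary \<and> ?f u v = ?f v u \<and> edge_color T u v \<in> {K, ?f u v}"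
    if "u \<in> verts T" "v \<in> verts T" "u \<noteq> v" for u v
    using edges[OF that] edge_color_sym[of T' u v] by (intro conjI) (elim conjE, assumption)+
  ultimately have "gallai_recoloring T (verts T) ?f"
    by (intro gallai_recoloringI)
  then show ?thesis by blast
qed

lemma diff_color_coords:
  "diff_color d = R \<Longrightarrow> d$1 > 0 \<and> d$2 > 0 \<and> d$3 \<le> 0"
  "diff_color d = G \<Longrightarrow> d$1 > 0 \<and> d$2 \<le> 0 \<and> d$3 > 0"
  "diff_color d = B \<Longrightarrow> d$1 \<le> 0 \<and> d$2 > 0 \<and> d$3 > 0"
  unfolding diff_color_def by (metis color.distinct)+

text \<open>
  Any two primary colors share a coordinate in which both differences are positive. The sum is then
  positive there, whereas the third primary color requires a nonpositive entry.
\<close>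

lemma diff_color_sum_not_rainbow:
  "{diff_color a, diff_color b, diff_color (a + b)} \<noteq> {R, G, B}"
proof
  assume *: "{diff_color a, diff_color b, diff_color (a + b)} = {R, G, B}"
  have "(p, q, r) \<in> {(R, G, B), (R, B, G), (G, R, B), (G, B, R), (B, R, G), (B, G, R)}"
    if "{p, q, r} = {R, G, B}" for p q r
    using that by (cases p; cases q; cases r; blast)
  from this[OF *] show False
    using diff_color_coords[of a] diff_color_coords[of b] diff_color_coords[of "a + b"]
    by (elim insertE) simp_all
qed

lemma geometric_imp_rainbow_triangle_free:
  assumes "geometric T"
  shows "rainbow_triangle_free T"
proof -
  obtain S where S: "same_tournament T (Color S)"
    using assms unfolding geometric_def by blast
  define L where "L = listing S"
  have col: "arc T u v \<Longrightarrow> col T u v = diff_color (L ! v - L ! u)" for u v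
    using S unfolding same_tournament_def L_def Color_def by auto
  show ?thesis
    unfolding rainbow_triangle_free_def
  proof safe
    fix u v w assume uv: "arc T u v" and vw: "arc T v w"
      and rainbow: "{col T u v, col T v w, col T u w} = {R, G, B}"
    have uw: "arc T u w" using uv vw by (auto simp: arc_def)
    have "L ! w - L ! u = (L ! v - L ! u) + (L ! w - L ! v)" by simp
    then show False
      using diff_color_sum_not_rainbow[of "L ! v - L ! u" "L ! w - L ! v"] rainbow
        col[OF uv] col[OF vw] col[OF uw] by metis
  qed
qed

lemma directed_gallai_on_imp_undirected: "directed_gallai_on T W \<Longrightarrow> undirected_gallai_on T W"
proof (induction rule: directed_gallai_on.induct)
  case (single v)
  then show ?case by (rule undirected_gallai_on.single)
next
  case (step W Hs)
  then have "\<forall>H\<in>set Hs. undirected_gallai_on T H" by blast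
  with step.hyps(1) show ?case by (rule undirected_gallai_on.step)
qed

text \<open>
  The blocks are recolored recursively, and all edges between two given blocks receive one color,
  taken from a set \<open>D\<close> of at most two. A triangle inside a block is not rainbow by induction; one
  that meets exactly two blocks has two sides between them, which agree; and one that meets three
  blocks uses only colors from \<open>D\<close>.
\<close>

lemma undirected_gallai_on_imp_recoloring:
  "undirected_gallai_on T W \<Longrightarrow> \<exists>f. gallai_recoloring T W f"
proof (induction rule: undirected_gallai_on.induct)
  case (single v)
  then show ?case by (auto simp: gallai_recoloring_def gallai_coloring_def)
next
  case (step W Hs)
  have part: "partition_on W (set Hs)"
    and one: "\<And>X Y. X \<in> set Hs \<Longrightarrow> Y \<in> set Hs \<Longrightarrow> X \<noteq> Y \<Longrightarrow> card (primary_between T X Y) \<le> 1"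
    and two: "card (\<Union>X\<in>set Hs. \<Union>Y\<in>set Hs - {X}. primary_between T X Y) \<le> 2"
    using step.hyps unfolding gallai_partition_def by auto
  obtain F where F: "\<And>H. H \<in> set Hs \<Longrightarrow> gallai_recoloring T H (F H)"
    using step.IH by metis
  define U where "U = (\<Union>X\<in>set Hs. \<Union>Y\<in>set Hs - {X}. primary_between T X Y)"
  \<comment> \<open>If only \<open>K\<close> occurs between blocks, any primary color may serve for these edges.\<close>
  define D where "D = (if U = {} then {R} else U)"
  have D: "D \<subseteq> primary" "U \<subseteq> D" "card D \<le> 2" "D \<noteq> {}"
    using two unfolding D_def U_def[symmetric] by (auto simp: U_def primary_between_def)
  have finD: "finite D" using D(1) by (rule finite_subset) simp
  have pb_sym: "primary_between T X Y = primary_between T Y X" for X Y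
    unfolding primary_between_def using edge_color_sym[of T] by blast
  define b where "b X Y = (SOME c. c \<in> D \<and> primary_between T X Y \<subseteq> {c})" for X Y
  have b_sym: "b X Y = b Y X" for X Y
    unfolding b_def pb_sym[of X Y] ..
  have b: "b X Y \<in> D \<and> primary_between T X Y \<subseteq> {b X Y}"
    if XY: "X \<in> set Hs" "Y \<in> set Hs" "X \<noteq> Y" for X Y
    unfolding b_def
  proof (rule someI_ex)
    let ?Q = "primary_between T X Y"
    have "finite ?Q" unfolding primary_between_def by simp
    moreover have "?Q \<subseteq> D" using D(2) XY unfolding U_def by blast
    ultimately show "\<exists>c. c \<in> D \<and> ?Q \<subseteq> {c}"
      using one[OF XY] D(4) by (cases "?Q = {}") (auto simp: le_Suc_eq card_1_singleton_iff)
  qed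
  have "\<forall>v\<in>W. \<exists>H. H \<in> set Hs \<and> v \<in> H"
    using partition_onD1[OF part] by blast
  then obtain h where h: "\<And>v. v \<in> W \<Longrightarrow> h v \<in> set Hs \<and> v \<in> h v" by metis
  define f where "f u v = (if h u = h v then F (h u) u v else b (h u) (h v))" for u v
  have inner: "gallai_coloring (F H) H"
    "u \<in> H \<Longrightarrow> v \<in> H \<Longrightarrow> u \<noteq> v \<Longrightarrow> edge_color T u v \<in> {K, F H u v}" if "H \<in> set Hs" for H u v
    using F[OF that] unfolding gallai_recoloring_def by auto
  have edges: "f u v \<in> primary \<and> f u v = f v u \<and> edge_color T u v \<in> {K, f u v}"
    if uv: "u \<in> W" "v \<in> W" "u \<noteq> v" for u v
  proof (cases "h u = h v")
    case True
    then show ?thesis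
      using inner(1)[of "h u"] inner(2)[of "h u" u v] gallai_coloring_primary[of "F (h u)" "h u" u v]
        gallai_coloring_sym[of "F (h u)" "h u" u v] h[OF uv(1)] h[OF uv(2)] uv(3)
      unfolding f_def by auto
  next
    case False
    have "edge_color T u v \<in> primary \<Longrightarrow> edge_color T u v \<in> primary_between T (h u) (h v)"
      using h[OF uv(1)] h[OF uv(2)] unfolding primary_between_def by blast
    then have "edge_color T u v \<in> {K, b (h u) (h v)}"
      using b[of "h u" "h v"] h[OF uv(1)] h[OF uv(2)] False by (cases "edge_color T u v") auto
    then show ?thesis
      using False b[of "h u" "h v"] b_sym h[OF uv(1)] h[OF uv(2)] D(1) unfolding f_def by auto
  qed
  have triangles: "f u v = f v w \<or> f u v = f u w \<or> f v w = f u w"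
    if uvw: "u \<in> W" "v \<in> W" "w \<in> W" "u \<noteq> v" "v \<noteq> w" "u \<noteq> w" for u v w
  proof -
    consider "h u = h v" "h v = h w" | "h u \<noteq> h v" "h v \<noteq> h w" "h u \<noteq> h w"
      | "h u = h v" "h v \<noteq> h w" | "h u = h w" "h v \<noteq> h w" | "h v = h w" "h u \<noteq> h v"
      by metis
    then show ?thesis
    proof cases
      case 1
      then show ?thesis
        using gallai_coloring_triangle[OF inner(1), of "h u" u v w] uvw(4-6)
          h[OF uvw(1)] h[OF uvw(2)] h[OF uvw(3)]
        unfolding f_def by auto
    next
      case 2
      show ?thesis
      proof (rule ccontr)
        assume neq: "\<not> ?thesis"
        have "f u v \<in> D" "f v w \<in> D" "f u w \<in> D"
          using 2 b h[OF uvw(1)] h[OF uvw(2)] h[OF uvw(3)] unfolding f_def by simp_all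
        then have "card {f u v, f v w, f u w} \<le> card D"
          using finD by (intro card_mono) simp_all
        then show False using neq D(3) by simp
      qed
    next
      case 3
      then have "f v w = f u w" unfolding f_def by simp
      then show ?thesis by blast
    next
      case 4
      then have "f u v = f v w" unfolding f_def using b_sym[of "h w" "h v"] by simp
      then show ?thesis by blast
    next
      case 5
      then have "f u v = f u w" unfolding f_def by simp
      then show ?thesis by blast
    qed
  qed
  have "gallai_recoloring T W f"
    using edges triangles by (rule gallai_recoloringI)
  then show ?case by blast
qed

section \<open>The main inequality\<close>

theorem theorem1p48:
  fixes T :: tournament
  assumes "canonically_almost morally_K_free T \<or>
           canonically_almost directed_gallai T \<or>
           canonically_almost undirected_gallai T \<or>
           canonically_almost morally_rainbow_triangle_free T"
  shows "ell T {R,G,K} * ell T {R,B,K} * ell T {G,B,K} \<ge> (card (verts T))\<^sup>2"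
proof (cases "order T = 0")
  \<comment> \<open>The empty tournament has no paths at all, so \<open>ell\<close> takes there the unspecified value
    \<open>Max {}\<close>; the inequality is then trivial because there are no vertices.\<close>
  case False
  obtain fs where fs: "set fs \<subseteq> {Color \<circ> Record, Dual}"
    and cases: "morally_K_free (foldr (\<circ>) fs id T) \<or> directed_gallai (foldr (\<circ>) fs id T) \<or>
      undirected_gallai (foldr (\<circ>) fs id T) \<or> morally_rainbow_triangle_free (foldr (\<circ>) fs id T)"
    using assms unfolding canonically_almost_def by blast
  define T' where "T' = foldr (\<circ>) fs id T"
  have "order T' = order T" and le: "\<And>d. d \<in> primary \<Longrightarrow> ell T' (- {d}) \<le> ell T (- {d})"
    using canonical_maps_ell_le[OF fs, of T] False unfolding T'_def by auto
  have "morally_rainbow_triangle_free T' \<or> undirected_gallai T'"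
    using cases geometric_imp_rainbow_triangle_free directed_gallai_on_imp_undirected
    unfolding T'_def morally_K_free_def morally_rainbow_triangle_free_def
      directed_gallai_def undirected_gallai_def by blast
  then obtain f where "gallai_recoloring T' (verts T') f"
    using morally_rainbow_triangle_free_imp_recoloring undirected_gallai_on_imp_recoloring
    unfolding undirected_gallai_def by blast
  then have "(card (verts T'))\<^sup>2 \<le> (\<Prod>d\<in>primary. ell T' (- {d}))"
    by (rule gallai_recoloring_ell)
  also have "\<dots> \<le> (\<Prod>d\<in>primary. ell T (- {d}))"
    using le by (intro prod_mono) auto
  also have "\<dots> = ell T {R,G,K} * ell T {R,B,K} * ell T {G,B,K}"
  proof -
    have "{R,G,K} = - {B}" "{R,B,K} = - {G}" "{G,B,K} = - {R}"
      using color.exhaust by auto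
    then show ?thesis by (simp add: mult.assoc mult.commute mult.left_commute)
  qed
  finally show ?thesis
    using \<open>order T' = order T\<close> by (simp add: verts_def)
qed (simp add: verts_def)
end
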